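(* Let $\Delta>0$, let $K\ge1$ be an integer, and let $h=K\Delta$. Assume that the covariance $Q$ is constant over the window and diagonal in a fixed radial–tangential orthonormal frame of $\mathbb R^2$, with eigenvalues $\lambda_\rho,\lambda_\theta\ge0$, not both zero, and that the receiver noise is i.i.d. Gaussian with covariance $nI_2$, $n>0$. For the raw gap estimator $$\widehat\delta=\frac1{K\Delta}\sum_{k=0}^{K-1}\Big[(\Delta Y^{\rm obs}_{\rho,k})^2-(\Delta Y^{\rm obs}_{\theta,k})^2\Big],$$ let $c_j=\lambda_j\Delta+2n$ for $j\in\{\rho,\theta\}$. Then $$\operatorname{Var}(\widehat\delta)=\frac{2}{K^2\Delta^2}\Big[K(c_\rho^2+c_\theta^2)+4(K-1)n^2\Big].$$ For $K=h/\Delta\gg1$, $$\operatorname{Var}(\widehat\delta)\simeq V_h(\Delta):=\frac2h\Big[\frac{12n^2}{\Delta}+4n(\lambda_\rho+\lambda_\theta)+(\lambda_\rho^2+\lambda_\theta^2)\Delta\Big]$$ (the ratio of the two sides tends to $1$ as $K\to\infty$ with $h=K\Delta$ fixed), and the interval $\Delta>0$ minimizing $V_h(\Delta)$ at fixed $h$ is $$\Delta_\star=\frac{2\sqrt3\,n}{\sqrt{\lambda_\rho^2+\lambda_\theta^2}} .$$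
   Context: The frozen Gaussian local model: on the window $[t_0,t_0+h]$ the signal satisfies $dY_t=G\,dW_t$ with $G$ constant, $W$ a standard Brownian motion and $Q=GG^\top$, so $Y$ takes values in $\mathbb R^2$. It is observed at times $t_k=t_0+k\Delta$, $k=0,\dots,K$, as $Y^{\rm obs}_k=Y_{t_k}+\varepsilon_k$, where the $\varepsilon_k\sim\mathcal N(0,nI_2)$ are i.i.d. and independent of $W$. The increments are $\Delta_kY^{\rm obs}=Y^{\rm obs}_{k+1}-Y^{\rm obs}_k$, and $\Delta Y^{\rm obs}_{\rho,k}$, $\Delta Y^{\rm obs}_{\theta,k}$ are their components in the radial and tangential directions of the fixed frame (the eigenvectors of $Q$ for $\lambda_\rho$ and $\lambda_\theta$). *)

theory Defs
  imports "HOL-Probability.Probability"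
begin

definition normal_law :: "real \<Rightarrow> real \<Rightarrow> real measure" where
  "normal_law m v =
     (if 0 < v then density lborel (\<lambda>x. ennreal (normal_density m (sqrt v) x))
      else return borel m)"

context prob_space
begin

text \<open>\<open>X \<sim> N(\<mu>, \<Sigma>)\<close>: every linear functional \<open>u \<bullet> X\<close> is normal with mean \<open>u \<bullet> \<mu>\<close>
  and variance \<open>u \<bullet> \<Sigma> u\<close>.  Degenerate covariances are allowed.  The library matrix
  \<open>mat v\<close> is \<open>v\<close> times the identity.\<close>

definition gaussian_vector :: "('a \<Rightarrow> real ^ 'd) \<Rightarrow> real ^ 'd \<Rightarrow> real ^ 'd ^ 'd \<Rightarrow> bool" where
  "gaussian_vector X \<mu> \<Sigma> \<longleftrightarrow>
     random_variable borel X \<and>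
     (\<forall>u. distr M borel (\<lambda>\<omega>. u \<bullet> X \<omega>) = normal_law (u \<bullet> \<mu>) (u \<bullet> (\<Sigma> *v u)))"

text \<open>The time axis is \<open>[0, \<infinity>)\<close>; values \<open>W t\<close> at \<open>t < 0\<close> are irrelevant.\<close>

definition standard_brownian_motion :: "(real \<Rightarrow> 'a \<Rightarrow> real ^ 'd) \<Rightarrow> bool" where
  "standard_brownian_motion W \<longleftrightarrow>
     (\<forall>t\<ge>0. random_variable borel (W t)) \<and>
     (AE \<omega> in M. W 0 \<omega> = 0) \<and>
     (\<forall>s t. 0 \<le> s \<and> s < t \<longrightarrow> gaussian_vector (\<lambda>\<omega>. W t \<omega> - W s \<omega>) 0 (mat (t - s))) \<and>
     (\<forall>(\<tau> :: nat \<Rightarrow> real) N. 0 \<le> \<tau> 0 \<and> (\<forall>i<N. \<tau> i < \<tau> (Suc i)) \<longrightarrow>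
        indep_vars (\<lambda>_. borel) (\<lambda>i \<omega>. W (\<tau> (Suc i)) \<omega> - W (\<tau> i) \<omega>) {..<N}) \<and>
     (AE \<omega> in M. continuous_on {0..} (\<lambda>t. W t \<omega>))"

end

text \<open>Signal on the window \<open>[t0, t0 + h]\<close> together with receiver noise at the sampling
  indices \<open>0, \<dots>, K\<close>.  Since \<open>G\<close> is constant, \<open>dY = G dW\<close> is stated in its integrated form;
  the initial value \<open>Y t0\<close> is an arbitrary random vector.  Independence of the noise from
  \<open>W\<close> is independence of the \<open>\<sigma>\<close>-algebras generated by the two whole families.\<close>

locale frozen_gaussian_model = prob_space M
  for M :: "'a measure" +
  fixes t0 h :: real
    and G :: "real ^ 'm ^ 2"
    and W :: "real \<Rightarrow> 'a \<Rightarrow> real ^ 'm"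
    and Y :: "real \<Rightarrow> 'a \<Rightarrow> real ^ 2"
    and n :: real
    and K :: nat
    and \<epsilon> :: "nat \<Rightarrow> 'a \<Rightarrow> real ^ 2"
  assumes start_nonneg: "0 \<le> t0"
    and brownian: "standard_brownian_motion W"
    and signal_measurable: "\<forall>t\<in>{t0..t0 + h}. random_variable borel (Y t)"
    and signal_sde:
      "AE \<omega> in M. \<forall>t\<in>{t0..t0 + h}. Y t \<omega> = Y t0 \<omega> + G *v (W t \<omega> - W t0 \<omega>)"
    and noise_gaussian: "\<forall>k\<le>K. gaussian_vector (\<epsilon> k) 0 (mat n)"
    and noise_indep: "indep_vars (\<lambda>_. borel) \<epsilon> {..K}"
    and noise_indep_brownian:
      "indep_set
         (sets (vimage_algebra (space M) (\<lambda>\<omega>. \<lambda>t\<in>{0..}. W t \<omega>) (PiM {0..} (\<lambda>_. borel))))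
         (sets (vimage_algebra (space M) (\<lambda>\<omega>. \<lambda>k\<in>{..K}. \<epsilon> k \<omega>) (PiM {..K} (\<lambda>_. borel))))"

definition observed ::
  "real \<Rightarrow> real \<Rightarrow> (real \<Rightarrow> 'a \<Rightarrow> real ^ 2) \<Rightarrow> (nat \<Rightarrow> 'a \<Rightarrow> real ^ 2) \<Rightarrow> nat \<Rightarrow> 'a \<Rightarrow> real ^ 2" where
  "observed t0 \<Delta> Y \<epsilon> k \<omega> = Y (t0 + real k * \<Delta>) \<omega> + \<epsilon> k \<omega>"

definition raw_gap_estimator ::
  "real ^ 2 \<Rightarrow> real ^ 2 \<Rightarrow> real \<Rightarrow> nat \<Rightarrow> (nat \<Rightarrow> 'a \<Rightarrow> real ^ 2) \<Rightarrow> 'a \<Rightarrow> real" where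
  "raw_gap_estimator e\<^sub>\<rho> e\<^sub>\<theta> \<Delta> K Yobs \<omega> =
     1 / (real K * \<Delta>) *
     (\<Sum>k<K. (e\<^sub>\<rho> \<bullet> (Yobs (Suc k) \<omega> - Yobs k \<omega>))\<^sup>2 - (e\<^sub>\<theta> \<bullet> (Yobs (Suc k) \<omega> - Yobs k \<omega>))\<^sup>2)"

definition V_approx :: "real \<Rightarrow> real \<Rightarrow> real \<Rightarrow> real \<Rightarrow> real \<Rightarrow> real" where
  "V_approx n lam\<^sub>\<rho> lam\<^sub>\<theta> h \<Delta> =
     2 / h * (12 * n\<^sup>2 / \<Delta> + 4 * n * (lam\<^sub>\<rho> + lam\<^sub>\<theta>) + (lam\<^sub>\<rho>\<^sup>2 + lam\<^sub>\<theta>\<^sup>2) * \<Delta>)"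

end

theory Submission
  imports Defs
begin

text \<open>
  The estimator is a signed sum of squares of jointly Gaussian, centred variables, the components
  \<open>Z\<close> of the observed increments along the two frame directions.  For such variables Isserlis'
  formula gives \<open>Cov(Z\<^sup>2, Z'\<^sup>2) = 2 Cov(Z, Z')\<^sup>2\<close>, so the variance of the estimator is a weighted
  sum of squared covariances (\<open>variance_weighted_sum_squares\<close>).  The covariances are elementary:
  radial and tangential components are uncorrelated because the frame diagonalizes \<open>Q\<close>, and along
  one direction the covariance matrix is tridiagonal, with \<open>c\<^sub>j\<close> on the diagonal and \<open>-n\<close> next to
  it, since consecutive increments share one noise term with opposite signs.  Squaring and summing
  produces \<open>K c\<^sub>j\<^sup>2 + 2 (K - 1) n\<^sup>2\<close> for each direction.

  Joint Gaussianity enters only through moments up to order four of linear combinations.  These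
  moments behave additively under independent sums (\<open>centred_normal_moments_add\<close>), so every linear
  form in the Brownian increments and the noise has the moments of a centred normal variable
  (\<open>linear_form_moments\<close>); covariances are then read off from the quadratic form giving its
  variance.  This treats degenerate directions, where \<open>\<lambda>\<^sub>j = 0\<close>, on the same footing.

  For fixed \<open>h\<close>, the exact variance falls short of \<open>V\<^sub>h\<close> by \<open>8 n\<^sup>2 / h\<^sup>2\<close>, independently of \<open>K\<close>, whereas
  \<open>V\<^sub>h\<close> grows at least linearly in \<open>K\<close>; hence the ratio tends to 1.  Finally, completing the square
  shows that \<open>V\<^sub>h(\<Delta>)\<close> exceeds its minimum by a positive multiple of \<open>(\<Delta> - \<Delta>\<^sub>\<star>)\<^sup>2 / \<Delta>\<close>.
\<close>

section \<open>Normal moments up to order four\<close>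

context prob_space
begin

text \<open>The part of being \<open>N(0, v)\<close> that the variance of a sum of squares depends on.  The odd
  moments are included because the even moments of an independent sum involve them.\<close>

definition centred_normal_moments :: "('a \<Rightarrow> real) \<Rightarrow> real \<Rightarrow> bool" where
  "centred_normal_moments X v \<longleftrightarrow>
     random_variable borel X \<and>
     has_bochner_integral M X 0 \<and>
     has_bochner_integral M (\<lambda>\<omega>. X \<omega> ^ 2) v \<and>
     has_bochner_integral M (\<lambda>\<omega>. X \<omega> ^ 3) 0 \<and>
     has_bochner_integral M (\<lambda>\<omega>. X \<omega> ^ 4) (3 * v\<^sup>2)"

lemma has_bochner_integral_distr_eq:
  assumes "random_variable borel X" and "f \<in> borel_measurable borel"
  shows "has_bochner_integral (distr M borel X) f c \<longleftrightarrow>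
         has_bochner_integral M (\<lambda>\<omega>. f (X \<omega>) :: real) (c :: real)"
  using assms by (simp add: has_bochner_integral_iff integrable_distr_eq integral_distr)

lemma centred_normal_moments_normal_law:
  assumes X: "random_variable borel X" and "0 \<le> v"
    and law: "distr M borel X = normal_law 0 v"
  shows "centred_normal_moments X v"
proof -
  have pow: "has_bochner_integral M (\<lambda>\<omega>. X \<omega> ^ k) c"
    if "has_bochner_integral (normal_law 0 v) (\<lambda>x. x ^ k) c" for k c
    using that X by (simp add: has_bochner_integral_distr_eq flip: law)
  have "has_bochner_integral (normal_law 0 v) (\<lambda>x. x ^ 1) 0 \<and>
        has_bochner_integral (normal_law 0 v) (\<lambda>x. x ^ 2) v \<and>
        has_bochner_integral (normal_law 0 v) (\<lambda>x. x ^ 3) 0 \<and>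
        has_bochner_integral (normal_law 0 v) (\<lambda>x. x ^ 4) (3 * v\<^sup>2)"
  proof (cases "0 < v")
    case True
    then have \<sigma>: "0 < sqrt v" and [simp]: "(sqrt v)\<^sup>2 = v" by simp_all
    have dens: "has_bochner_integral (normal_law 0 v) (\<lambda>x. x ^ k) c"
      if "has_bochner_integral lborel (\<lambda>x. normal_density 0 (sqrt v) x * (x - 0) ^ k) c" for k c
      unfolding normal_law_def using True that
      by (auto intro!: has_bochner_integral_density)
    have "has_bochner_integral (normal_law 0 v) (\<lambda>x. x ^ 1) 0"
      using normal_moment_odd[OF \<sigma>, of 0 0] by (intro dens) simp
    moreover have "has_bochner_integral (normal_law 0 v) (\<lambda>x. x ^ 2) v"
      using normal_moment_even[OF \<sigma>, of 0 1] by (intro dens) simp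
    moreover have "has_bochner_integral (normal_law 0 v) (\<lambda>x. x ^ 3) 0"
      using normal_moment_odd[OF \<sigma>, of 0 1] by (intro dens) simp
    moreover have "fact 4 / ((2 / v)\<^sup>2 * fact 2) = 3 * v\<^sup>2"
      using True by (simp add: fact_numeral power2_eq_square)
    then have "has_bochner_integral (normal_law 0 v) (\<lambda>x. x ^ 4) (3 * v\<^sup>2)"
      using normal_moment_even[OF \<sigma>, of 0 2] by (intro dens) simp
    ultimately show ?thesis by blast
  next
    case False
    with \<open>0 \<le> v\<close> have "v = 0" by simp
    have "has_bochner_integral (return borel (0::real)) (\<lambda>x. x ^ k) (0 ^ k)" for k :: nat
    proof -
      interpret R: prob_space "return borel (0::real)" by (rule prob_space_return) simp
      have "has_bochner_integral (return borel (0::real)) (\<lambda>x. 0 ^ k) (0 ^ k :: real)"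
        using R.integrable_const[of "0 ^ k :: real"] R.prob_space by (simp add: has_bochner_integral_iff)
      then show ?thesis
        by (subst has_bochner_integral_cong_AE[where g = "\<lambda>x. 0 ^ k"]) (auto simp: AE_return)
    qed
    from this[of 1] this[of 2] this[of 3] this[of 4] show ?thesis
      by (simp add: normal_law_def \<open>v = 0\<close>)
  qed
  then show ?thesis
    using X pow[of 1 0] pow[of 2 v] pow[of 3 0] pow[of 4 "3 * v\<^sup>2"]
    by (simp add: centred_normal_moments_def)
qed

lemma indep_var_mult_has_bochner_integral:
  fixes X Y :: "'a \<Rightarrow> real"
  assumes "indep_var borel X borel Y"
    and "has_bochner_integral M X a" and "has_bochner_integral M Y b"
  shows "has_bochner_integral M (\<lambda>\<omega>. X \<omega> * Y \<omega>) (a * b)"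
  using assms indep_var_integrable[OF assms(1)] indep_var_lebesgue_integral[OF assms(1)]
  by (simp add: has_bochner_integral_iff)

text \<open>In the binomial expansion of \<open>(X + Y)\<^sup>k\<close> all mixed moments factor, and those with an odd
  exponent vanish.  For \<open>k = 4\<close> what remains is \<open>3 v\<^sup>2 + 6 v w + 3 w\<^sup>2 = 3 (v + w)\<^sup>2\<close>, which is why the
  normal value of the fourth moment is preserved.\<close>

lemma centred_normal_moments_add:
  assumes indep: "indep_var borel X borel Y"
    and X: "centred_normal_moments X v" and Y: "centred_normal_moments Y w"
  shows "centred_normal_moments (\<lambda>\<omega>. X \<omega> + Y \<omega>) (v + w)"
proof -
  \<comment> \<open>First powers are kept as \<open>X \<omega> ^ 1\<close> so that one rule covers every mixed moment.\<close>
  note X = X[unfolded centred_normal_moments_def] and Y = Y[unfolded centred_normal_moments_def]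
  have mixed: "has_bochner_integral M (\<lambda>\<omega>. c * (X \<omega> ^ i * Y \<omega> ^ j)) (c * (a * b))"
    if "has_bochner_integral M (\<lambda>\<omega>. X \<omega> ^ i) a" "has_bochner_integral M (\<lambda>\<omega>. Y \<omega> ^ j) b" for i j a b c
  proof -
    have "indep_var borel (\<lambda>\<omega>. X \<omega> ^ i) borel (\<lambda>\<omega>. Y \<omega> ^ j)"
      using indep_var_compose[OF indep, of "\<lambda>x. x ^ i" borel "\<lambda>x. x ^ j" borel] by (simp add: comp_def)
    from indep_var_mult_has_bochner_integral[OF this that] show ?thesis
      by (rule has_bochner_integral_mult_right)
  qed
  have X1: "has_bochner_integral M (\<lambda>\<omega>. X \<omega> ^ 1) 0" and Y1: "has_bochner_integral M (\<lambda>\<omega>. Y \<omega> ^ 1) 0"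
    using X Y by simp_all
  have m1: "has_bochner_integral M (\<lambda>\<omega>. X \<omega> + Y \<omega>) (0 + 0)"
    using X Y by (intro has_bochner_integral_add) auto
  have m2: "has_bochner_integral M (\<lambda>\<omega>. X \<omega> ^ 2 + 2 * (X \<omega> ^ 1 * Y \<omega> ^ 1) + Y \<omega> ^ 2) (v + 2 * (0 * 0) + w)"
    using X Y X1 Y1 by (intro has_bochner_integral_add mixed) auto
  have m3: "has_bochner_integral M
      (\<lambda>\<omega>. X \<omega> ^ 3 + 3 * (X \<omega> ^ 2 * Y \<omega> ^ 1) + 3 * (X \<omega> ^ 1 * Y \<omega> ^ 2) + Y \<omega> ^ 3)
      (0 + 3 * (v * 0) + 3 * (0 * w) + 0)"
    using X Y X1 Y1 by (intro has_bochner_integral_add mixed) auto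
  have m4: "has_bochner_integral M
      (\<lambda>\<omega>. X \<omega> ^ 4 + 4 * (X \<omega> ^ 3 * Y \<omega> ^ 1) + 6 * (X \<omega> ^ 2 * Y \<omega> ^ 2) + 4 * (X \<omega> ^ 1 * Y \<omega> ^ 3) + Y \<omega> ^ 4)
      (3 * v\<^sup>2 + 4 * (0 * 0) + 6 * (v * w) + 4 * (0 * 0) + 3 * w\<^sup>2)"
    using X Y X1 Y1 by (intro has_bochner_integral_add mixed) auto
  have e2: "(\<lambda>\<omega>. X \<omega> ^ 2 + 2 * (X \<omega> ^ 1 * Y \<omega> ^ 1) + Y \<omega> ^ 2) = (\<lambda>\<omega>. (X \<omega> + Y \<omega>) ^ 2)"
    by (auto simp: power2_eq_square algebra_simps)
  have e3: "(\<lambda>\<omega>. X \<omega> ^ 3 + 3 * (X \<omega> ^ 2 * Y \<omega> ^ 1) + 3 * (X \<omega> ^ 1 * Y \<omega> ^ 2) + Y \<omega> ^ 3)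
      = (\<lambda>\<omega>. (X \<omega> + Y \<omega>) ^ 3)"
    by (auto simp: eval_nat_numeral algebra_simps)
  have e4: "(\<lambda>\<omega>. X \<omega> ^ 4 + 4 * (X \<omega> ^ 3 * Y \<omega> ^ 1) + 6 * (X \<omega> ^ 2 * Y \<omega> ^ 2) + 4 * (X \<omega> ^ 1 * Y \<omega> ^ 3) + Y \<omega> ^ 4)
      = (\<lambda>\<omega>. (X \<omega> + Y \<omega>) ^ 4)"
    by (auto simp: eval_nat_numeral algebra_simps)
  have "3 * v\<^sup>2 + 4 * (0 * 0) + 6 * (v * w) + 4 * (0 * 0) + 3 * w\<^sup>2 = 3 * (v + w)\<^sup>2"
    by (simp add: power2_eq_square algebra_simps)
  then show ?thesis
    using m1 m2 m3 m4 X Y unfolding centred_normal_moments_def e2 e3 e4 by simp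
qed

lemma centred_normal_moments_sum:
  assumes "finite I" and "indep_vars (\<lambda>_. borel) X I"
    and "\<And>i. i \<in> I \<Longrightarrow> centred_normal_moments (X i) (v i)"
  shows "centred_normal_moments (\<lambda>\<omega>. \<Sum>i\<in>I. X i \<omega>) (\<Sum>i\<in>I. v i)"
  using assms
proof (induction I)
  case empty
  show ?case by (simp add: centred_normal_moments_def has_bochner_integral_zero)
next
  case (insert i I)
  have "indep_var borel (X i) borel (\<lambda>\<omega>. \<Sum>i\<in>I. X i \<omega>)"
    using insert.hyps insert.prems(1) by (rule indep_vars_sum)
  moreover have "centred_normal_moments (\<lambda>\<omega>. \<Sum>i\<in>I. X i \<omega>) (\<Sum>i\<in>I. v i)"
    using insert.prems by (intro insert.IH) (auto intro: indep_vars_subset)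
  ultimately show ?case
    using insert by (simp add: centred_normal_moments_add)
qed

text \<open>Isserlis' formula for \<open>E[Z\<^sup>2 Z'\<^sup>2]\<close>, by polarization: the product of squares is a combination
  of the fourth powers of \<open>Z + Z'\<close>, \<open>Z - Z'\<close>, \<open>Z\<close> and \<open>Z'\<close>.  Here \<open>p\<close>, \<open>r\<close> are the variances and \<open>q\<close> is
  the covariance, all encoded in the variance of a general linear combination.\<close>

lemma isserlis_squares:
  assumes "\<And>x y. centred_normal_moments (\<lambda>\<omega>. x * Z \<omega> + y * Z' \<omega>) (x\<^sup>2 * p + 2 * x * y * q + y\<^sup>2 * r)"
  shows "has_bochner_integral M (\<lambda>\<omega>. (Z \<omega>)\<^sup>2 * (Z' \<omega>)\<^sup>2) (p * r + 2 * q\<^sup>2)"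
proof -
  have m: "has_bochner_integral M (\<lambda>\<omega>. (x * Z \<omega> + y * Z' \<omega>) ^ 4) (3 * (x\<^sup>2 * p + 2 * x * y * q + y\<^sup>2 * r)\<^sup>2)"
    for x y using assms[of x y] by (simp add: centred_normal_moments_def)
  have "has_bochner_integral M
     (\<lambda>\<omega>. 1/12 * ((1 * Z \<omega> + 1 * Z' \<omega>) ^ 4 + (1 * Z \<omega> + (-1) * Z' \<omega>) ^ 4
        - 2 * (1 * Z \<omega> + 0 * Z' \<omega>) ^ 4 - 2 * (0 * Z \<omega> + 1 * Z' \<omega>) ^ 4))
     (1/12 * (3 * (1\<^sup>2 * p + 2 * 1 * 1 * q + 1\<^sup>2 * r)\<^sup>2 + 3 * (1\<^sup>2 * p + 2 * 1 * (-1) * q + (-1)\<^sup>2 * r)\<^sup>2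
        - 2 * (3 * (1\<^sup>2 * p + 2 * 1 * 0 * q + 0\<^sup>2 * r)\<^sup>2) - 2 * (3 * (0\<^sup>2 * p + 2 * 0 * 1 * q + 1\<^sup>2 * r)\<^sup>2)))"
    by (intro has_bochner_integral_mult_right has_bochner_integral_add has_bochner_integral_diff m)
  moreover have "(\<lambda>\<omega>. 1/12 * ((1 * Z \<omega> + 1 * Z' \<omega>) ^ 4 + (1 * Z \<omega> + (-1) * Z' \<omega>) ^ 4
        - 2 * (1 * Z \<omega> + 0 * Z' \<omega>) ^ 4 - 2 * (0 * Z \<omega> + 1 * Z' \<omega>) ^ 4)) = (\<lambda>\<omega>. (Z \<omega>)\<^sup>2 * (Z' \<omega>)\<^sup>2)"
    by (auto simp: eval_nat_numeral algebra_simps)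
  moreover have "1/12 * (3 * (1\<^sup>2 * p + 2 * 1 * 1 * q + 1\<^sup>2 * r)\<^sup>2 + 3 * (1\<^sup>2 * p + 2 * 1 * (-1) * q + (-1)\<^sup>2 * r)\<^sup>2
        - 2 * (3 * (1\<^sup>2 * p + 2 * 1 * 0 * q + 0\<^sup>2 * r)\<^sup>2) - 2 * (3 * (0\<^sup>2 * p + 2 * 0 * 1 * q + 1\<^sup>2 * r)\<^sup>2))
      = p * r + 2 * q\<^sup>2"
    by (simp add: power2_eq_square algebra_simps)
  ultimately show ?thesis by (simp only:)
qed

text \<open>By Isserlis' formula \<open>Cov(Z\<^sub>i\<^sup>2, Z\<^sub>j\<^sup>2) = 2 C\<^sub>i\<^sub>j\<^sup>2\<close>: in the second moment of the sum, the
  products \<open>C\<^sub>i\<^sub>i C\<^sub>j\<^sub>j\<close> add up to the squared mean and cancel.\<close>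

lemma variance_weighted_sum_squares:
  fixes Z :: "'i \<Rightarrow> 'a \<Rightarrow> real" and C :: "'i \<Rightarrow> 'i \<Rightarrow> real"
  assumes pair: "\<And>i j x y. i \<in> I \<Longrightarrow> j \<in> I \<Longrightarrow>
      centred_normal_moments (\<lambda>\<omega>. x * Z i \<omega> + y * Z j \<omega>) (x\<^sup>2 * C i i + 2 * x * y * C i j + y\<^sup>2 * C j j)"
  shows "variance (\<lambda>\<omega>. \<Sum>i\<in>I. w i * (Z i \<omega>)\<^sup>2) = 2 * (\<Sum>i\<in>I. \<Sum>j\<in>I. w i * w j * (C i j)\<^sup>2)"
proof -
  have "has_bochner_integral M (\<lambda>\<omega>. (Z i \<omega>)\<^sup>2) (C i i)" if "i \<in> I" for i
    using pair[OF that that, of 1 0] by (simp add: centred_normal_moments_def)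
  then have first: "has_bochner_integral M (\<lambda>\<omega>. \<Sum>i\<in>I. w i * (Z i \<omega>)\<^sup>2) (\<Sum>i\<in>I. w i * C i i)"
    by (intro has_bochner_integral_sum has_bochner_integral_mult_right)
  have "has_bochner_integral M (\<lambda>\<omega>. \<Sum>i\<in>I. \<Sum>j\<in>I. w i * w j * ((Z i \<omega>)\<^sup>2 * (Z j \<omega>)\<^sup>2))
      (\<Sum>i\<in>I. \<Sum>j\<in>I. w i * w j * (C i i * C j j + 2 * (C i j)\<^sup>2))"
    by (intro has_bochner_integral_sum has_bochner_integral_mult_right isserlis_squares pair)
  then have second: "has_bochner_integral M (\<lambda>\<omega>. (\<Sum>i\<in>I. w i * (Z i \<omega>)\<^sup>2)\<^sup>2)
      (\<Sum>i\<in>I. \<Sum>j\<in>I. w i * w j * (C i i * C j j + 2 * (C i j)\<^sup>2))"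
    by (simp add: power2_eq_square sum_product mult_ac)
  have "(\<Sum>i\<in>I. \<Sum>j\<in>I. w i * w j * (C i i * C j j + 2 * (C i j)\<^sup>2))
      = (\<Sum>i\<in>I. w i * C i i)\<^sup>2 + 2 * (\<Sum>i\<in>I. \<Sum>j\<in>I. w i * w j * (C i j)\<^sup>2)"
    by (simp add: power2_eq_square sum_product sum.distrib sum_distrib_left algebra_simps)
  then show ?thesis
    using first second by (subst variance_eq) (auto simp: has_bochner_integral_iff)
qed

end

section \<open>Gaussian vectors, independence and tridiagonal sums\<close>

lemma mat_vector_mult: "mat c *v u = c *\<^sub>R (u :: real ^ 'd)"
proof -
  have "(\<Sum>j\<in>UNIV. (if i = j then c else 0) * u $ j) = c * u $ i" for i
    by (simp add: if_distrib[of "\<lambda>t. t * _"] cong: if_cong)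
  then show ?thesis
    by (simp add: vec_eq_iff matrix_vector_mult_def mat_def)
qed

lemma (in prob_space) gaussian_vector_inner_moments:
  assumes X: "gaussian_vector X 0 (mat v)" and "0 \<le> v"
  shows "centred_normal_moments (\<lambda>\<omega>. u \<bullet> X \<omega>) (v * (u \<bullet> u))"
proof (rule centred_normal_moments_normal_law)
  have [measurable]: "random_variable borel X"
    using X by (simp add: gaussian_vector_def)
  show "random_variable borel (\<lambda>\<omega>. u \<bullet> X \<omega>)" by measurable
  show "0 \<le> v * (u \<bullet> u)" using \<open>0 \<le> v\<close> by simp
  show "distr M borel (\<lambda>\<omega>. u \<bullet> X \<omega>) = normal_law 0 (v * (u \<bullet> u))"
    using X by (simp add: gaussian_vector_def mat_vector_mult)
qed

text \<open>Independence of two \<open>\<sigma>\<close>-algebras is inherited by random variables measurable with respect to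
  them.  The Brownian path and the noise sequence are families over different index types, so their
  independence has to be expressed by \<open>\<sigma>\<close>-algebras; this passes from there to functionals of
  them.\<close>

lemma (in prob_space) indep_var_of_indep_set:
  assumes indep: "indep_set (sets A) (sets B)"
    and X: "X \<in> measurable A S" and Y: "Y \<in> measurable B T"
    and space: "space A = space M" "space B = space M"
  shows "indep_var S X T Y"
proof -
  have sub: "sets A \<subseteq> events" "sets B \<subseteq> events"
    using indep by (auto simp: indep_set_def indep_sets_def split: bool.splits)
  have gen: "sigma_sets (space M) {X -` D \<inter> space M | D. D \<in> sets S} \<subseteq> sets A"
    "sigma_sets (space M) {Y -` D \<inter> space M | D. D \<in> sets T} \<subseteq> sets B"
    using measurable_sets[OF X] measurable_sets[OF Y]
      sets.sigma_sets_subset[of "{X -` D \<inter> space M | D. D \<in> sets S}" A]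
      sets.sigma_sets_subset[of "{Y -` D \<inter> space M | D. D \<in> sets T}" B]
    by (auto simp: space)
  have "random_variable S X" "random_variable T Y"
    using X Y sub space by (auto simp: measurable_def)
  moreover have "indep_set (sigma_sets (space M) {X -` D \<inter> space M | D. D \<in> sets S})
      (sigma_sets (space M) {Y -` D \<inter> space M | D. D \<in> sets T})"
    using indep gen unfolding indep_set_def by (elim indep_sets_mono_sets) (auto split: bool.split)
  ultimately show ?thesis
    by (simp add: indep_var_eq)
qed

lemma sum_of_bool_eq:
  fixes f :: "'i \<Rightarrow> real"
  assumes "finite A" and "k \<in> A"
  shows "(\<Sum>j\<in>A. of_bool (j = k) * f j) = f k"
  using assms by (simp add: of_bool_def if_distrib[of "\<lambda>t. t * _"] cong: if_cong)

text \<open>The noise enters the \<open>k\<close>-th observed increment with weight \<open>1\<close> at \<open>k + 1\<close> and \<open>-1\<close> at \<open>k\<close>; pairing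
  these weights with a function takes its difference.\<close>

lemma sum_difference_stencil:
  fixes f :: "nat \<Rightarrow> real"
  assumes "k < K"
  shows "(\<Sum>j\<le>K. (of_bool (j = Suc k) - of_bool (j = k)) * f j) = f (Suc k) - f k"
  using assms by (simp add: left_diff_distrib sum_subtractf sum_of_bool_eq)

text \<open>The squared Frobenius norm of the \<open>K \<times> K\<close> tridiagonal matrix with \<open>a\<close> on the diagonal and \<open>-b\<close>
  beside it; each of the two off-diagonals has \<open>K - 1\<close> entries.\<close>

lemma sum_tridiagonal_squares:
  fixes a b :: real
  assumes "1 \<le> K"
  shows "(\<Sum>k<K. \<Sum>l<K. (of_bool (k = l) * a - (of_bool (k = Suc l) + of_bool (l = Suc k)) * b)\<^sup>2)
    = real K * a\<^sup>2 + 2 * (real K - 1) * b\<^sup>2"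
proof -
  have sup: "(\<Sum>l<K. \<Sum>k<K. of_bool (k = Suc l)) = real K - 1"
  proof -
    obtain m where m: "K = Suc m" using assms by (cases K) auto
    have "(\<Sum>l<K. \<Sum>k<K. of_bool (k = Suc l) :: real) = (\<Sum>l<K. of_bool (l < m))"
      by (rule sum.cong) (auto simp: m of_bool_def)
    also have "\<dots> = real m" by (simp add: m)
    finally show ?thesis by (simp add: m)
  qed
  have "(of_bool (k = l) * a - (of_bool (k = Suc l) + of_bool (l = Suc k)) * b)\<^sup>2
      = of_bool (l = k) * a\<^sup>2 + (of_bool (k = Suc l) * b\<^sup>2 + of_bool (l = Suc k) * b\<^sup>2)" for k l
    by auto
  moreover have "(\<Sum>k<K. \<Sum>l<K. of_bool (l = k) * a\<^sup>2) = real K * a\<^sup>2"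
    by (simp add: sum_of_bool_eq)
  moreover have "(\<Sum>k<K. \<Sum>l<K. of_bool (l = Suc k) * b\<^sup>2) = (real K - 1) * b\<^sup>2"
    using sup by (simp flip: sum_distrib_right)
  moreover have "(\<Sum>k<K. \<Sum>l<K. of_bool (k = Suc l) * b\<^sup>2) = (real K - 1) * b\<^sup>2"
    using sup by (subst sum.swap) (simp flip: sum_distrib_right)
  ultimately show ?thesis
    by (simp add: sum.distrib)
qed

section \<open>The observed increments as a Gaussian family\<close>

context frozen_gaussian_model
begin

definition increment :: "real \<Rightarrow> nat \<Rightarrow> 'a \<Rightarrow> real ^ 'm" where
  "increment \<Delta> j \<omega> = W (t0 + real (Suc j) * \<Delta>) \<omega> - W (t0 + real j * \<Delta>) \<omega>"

text \<open>The component along \<open>e\<close> of the \<open>k\<close>-th observed increment, with the signal increment replaced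
  by the Brownian expression it equals almost surely.\<close>

definition driven_increment :: "real \<Rightarrow> real ^ 2 \<Rightarrow> nat \<Rightarrow> 'a \<Rightarrow> real" where
  "driven_increment \<Delta> e k \<omega> = e \<bullet> (G *v increment \<Delta> k \<omega> + (\<epsilon> (Suc k) \<omega> - \<epsilon> k \<omega>))"

text \<open>The covariance of the components along \<open>e\<close> and \<open>f\<close> of the \<open>k\<close>-th and \<open>l\<close>-th observed increments;
  \<open>driven_increment_pair_moments\<close> justifies the name.\<close>

definition increment_covariance :: "real \<Rightarrow> real ^ 2 \<Rightarrow> nat \<Rightarrow> real ^ 2 \<Rightarrow> nat \<Rightarrow> real" where
  "increment_covariance \<Delta> e k f l =
     of_bool (k = l) * (\<Delta> * (e \<bullet> (G ** transpose G *v f)) + 2 * n * (e \<bullet> f))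
     - (of_bool (k = Suc l) + of_bool (l = Suc k)) * (n * (e \<bullet> f))"

lemma W_measurable: "0 \<le> t \<Longrightarrow> random_variable borel (W t)"
  using brownian by (simp add: standard_brownian_motion_def)

lemma noise_measurable: "k \<le> K \<Longrightarrow> random_variable borel (\<epsilon> k)"
  using noise_gaussian by (simp add: gaussian_vector_def)

text \<open>Independence acts at three levels: between Brownian increments, between noise vectors, and
  between the two groups.  The quadratic form is diagonal because each block has a scalar
  covariance matrix, \<open>\<Delta> I\<close> or \<open>n I\<close>.\<close>

lemma linear_form_moments:
  assumes "0 < \<Delta>" and "0 \<le> n"
  shows "centred_normal_moments
     (\<lambda>\<omega>. (\<Sum>j<K. p j \<bullet> increment \<Delta> j \<omega>) + (\<Sum>j\<le>K. q j \<bullet> \<epsilon> j \<omega>))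
     (\<Delta> * (\<Sum>j<K. p j \<bullet> p j) + n * (\<Sum>j\<le>K. q j \<bullet> q j))"
proof (rule centred_normal_moments_add)
  define \<tau> where "\<tau> = (\<lambda>j. t0 + real j * \<Delta>)"
  have \<tau>: "0 \<le> \<tau> j" "\<tau> j < \<tau> (Suc j)" "\<tau> (Suc j) - \<tau> j = \<Delta>" for j
    using \<open>0 < \<Delta>\<close> start_nonneg by (simp_all add: \<tau>_def algebra_simps)
  have inc: "increment \<Delta> j = (\<lambda>\<omega>. W (\<tau> (Suc j)) \<omega> - W (\<tau> j) \<omega>)" for j
    by (simp add: increment_def \<tau>_def fun_eq_iff)
  show "indep_var borel (\<lambda>\<omega>. \<Sum>j<K. p j \<bullet> increment \<Delta> j \<omega>) borel (\<lambda>\<omega>. \<Sum>j\<le>K. q j \<bullet> \<epsilon> j \<omega>)"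
  proof (rule indep_var_of_indep_set[OF noise_indep_brownian])
    have "(\<lambda>w. \<Sum>j<K. p j \<bullet> (w (\<tau> (Suc j)) - w (\<tau> j))) \<in> borel_measurable (PiM {0..} (\<lambda>_. borel))"
      using \<tau>(1)
      by (intro borel_measurable_sum borel_measurable_inner borel_measurable_diff
          borel_measurable_const measurable_component_singleton) auto
    from measurable_compose[OF measurable_vimage_algebra1[of "\<lambda>\<omega>. \<lambda>t\<in>{0..}. W t \<omega>" "space M"] this]
    show "(\<lambda>\<omega>. \<Sum>j<K. p j \<bullet> increment \<Delta> j \<omega>) \<in> borel_measurable
        (vimage_algebra (space M) (\<lambda>\<omega>. \<lambda>t\<in>{0..}. W t \<omega>) (PiM {0..} (\<lambda>_. borel)))"
      using \<tau>(1) by (simp add: inc space_PiM)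
    have "(\<lambda>x. \<Sum>j\<le>K. q j \<bullet> x j) \<in> borel_measurable (PiM {..K} (\<lambda>_. borel))"
      by (intro borel_measurable_sum borel_measurable_inner borel_measurable_const
          measurable_component_singleton) auto
    from measurable_compose[OF measurable_vimage_algebra1[of "\<lambda>\<omega>. \<lambda>k\<in>{..K}. \<epsilon> k \<omega>" "space M"] this]
    show "(\<lambda>\<omega>. \<Sum>j\<le>K. q j \<bullet> \<epsilon> j \<omega>) \<in> borel_measurable
        (vimage_algebra (space M) (\<lambda>\<omega>. \<lambda>k\<in>{..K}. \<epsilon> k \<omega>) (PiM {..K} (\<lambda>_. borel)))"
      by (simp add: space_PiM)
  qed simp_all
  have "indep_vars (\<lambda>_. borel) (\<lambda>j. increment \<Delta> j) {..<K}"
    using brownian \<tau> unfolding inc standard_brownian_motion_def by blast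
  then have "indep_vars (\<lambda>_. borel) (\<lambda>j \<omega>. p j \<bullet> increment \<Delta> j \<omega>) {..<K}"
    by (rule indep_vars_compose2) simp
  moreover have "gaussian_vector (increment \<Delta> j) 0 (mat \<Delta>)" for j
    using brownian \<tau>[of j] unfolding inc standard_brownian_motion_def by metis
  then have "centred_normal_moments (\<lambda>\<omega>. p j \<bullet> increment \<Delta> j \<omega>) (\<Delta> * (p j \<bullet> p j))" for j
    using \<open>0 < \<Delta>\<close> by (intro gaussian_vector_inner_moments) auto
  ultimately show "centred_normal_moments (\<lambda>\<omega>. \<Sum>j<K. p j \<bullet> increment \<Delta> j \<omega>) (\<Delta> * (\<Sum>j<K. p j \<bullet> p j))"
    unfolding sum_distrib_left by (intro centred_normal_moments_sum) auto
  have "indep_vars (\<lambda>_. borel) (\<lambda>j \<omega>. q j \<bullet> \<epsilon> j \<omega>) {..K}"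
    using noise_indep by (rule indep_vars_compose2) simp
  moreover have "centred_normal_moments (\<lambda>\<omega>. q j \<bullet> \<epsilon> j \<omega>) (n * (q j \<bullet> q j))" if "j \<le> K" for j
    using noise_gaussian \<open>0 \<le> n\<close> that by (intro gaussian_vector_inner_moments) auto
  ultimately show "centred_normal_moments (\<lambda>\<omega>. \<Sum>j\<le>K. q j \<bullet> \<epsilon> j \<omega>) (n * (\<Sum>j\<le>K. q j \<bullet> q j))"
    unfolding sum_distrib_left by (intro centred_normal_moments_sum) auto
qed

text \<open>A combination of two observed increments is a linear form in the independent inputs, and
  expanding its quadratic form in \<open>x\<close> and \<open>y\<close> shows the covariance as half the coefficient of \<open>x y\<close>.
  The signal contributes only when \<open>k = l\<close>.  The noise weights of the two increments overlap in two
  places with equal signs when \<open>k = l\<close>, and in one place with opposite signs when \<open>k\<close> and \<open>l\<close> are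
  adjacent.\<close>

lemma driven_increment_pair_moments:
  assumes "0 < \<Delta>" and "0 \<le> n" and k: "k < K" and l: "l < K"
  shows "centred_normal_moments (\<lambda>\<omega>. x * driven_increment \<Delta> e k \<omega> + y * driven_increment \<Delta> f l \<omega>)
     (x\<^sup>2 * increment_covariance \<Delta> e k e k + 2 * x * y * increment_covariance \<Delta> e k f l
        + y\<^sup>2 * increment_covariance \<Delta> f l f l)"
proof -
  \<comment> \<open>\<open>P e k\<close> and \<open>N e k\<close> are the coefficient vectors of the \<open>k\<close>-th increment along \<open>e\<close>, with respect
     to the Brownian increments and to the noise.\<close>
  define g where "g e = transpose G *v e" for e :: "real ^ 2"
  define P where "P e k j = of_bool (j = k) *\<^sub>R g e" for e and k j :: nat
  define N where "N e k j = (of_bool (j = Suc k) - of_bool (j = k)) *\<^sub>R e" for e :: "real ^ 2" and k j :: nat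
  have adj: "e \<bullet> (G *v w) = g e \<bullet> w" for e w
    by (simp add: g_def dot_lmul_matrix flip: vector_transpose_matrix)
  have form: "driven_increment \<Delta> e k \<omega> = (\<Sum>j<K. P e k j \<bullet> increment \<Delta> j \<omega>) + (\<Sum>j\<le>K. N e k j \<bullet> \<epsilon> j \<omega>)"
    if "k < K" for e k \<omega>
    using that by (simp add: driven_increment_def P_def N_def inner_add_right inner_diff_right adj
        sum_of_bool_eq sum_difference_stencil)
  have cov: "\<Delta> * (\<Sum>j<K. P e k j \<bullet> P f l j) + n * (\<Sum>j\<le>K. N e k j \<bullet> N f l j) = increment_covariance \<Delta> e k f l"
    if "k < K" "l < K" for e k f l
  proof -
    have PP: "(\<Sum>j<K. P e k j \<bullet> P f l j) = of_bool (k = l) * (g e \<bullet> g f)"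
      using that by (simp add: P_def sum_of_bool_eq)
    have gg: "g e \<bullet> g f = e \<bullet> (G ** transpose G *v f)"
      by (simp add: g_def adj flip: matrix_vector_mul_assoc)
    have NN: "(\<Sum>j\<le>K. N e k j \<bullet> N f l j)
        = (of_bool (k = l) - of_bool (Suc k = l)) * (e \<bullet> f) - (of_bool (k = Suc l) - of_bool (k = l)) * (e \<bullet> f)"
    proof -
      have "(\<Sum>j\<le>K. N e k j \<bullet> N f l j) = (\<Sum>j\<le>K. (of_bool (j = Suc k) - of_bool (j = k))
          * ((of_bool (j = Suc l) - of_bool (j = l)) * (e \<bullet> f)))"
        by (simp add: N_def mult_ac)
      then show ?thesis
        using sum_difference_stencil[OF that(1)] by simp
    qed
    show ?thesis
      unfolding PP gg NN by (auto simp: increment_covariance_def algebra_simps)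
  qed
  have bilin: "(\<Sum>j\<in>A. (x *\<^sub>R a j + y *\<^sub>R b j) \<bullet> (x *\<^sub>R a j + y *\<^sub>R b j))
      = x\<^sup>2 * (\<Sum>j\<in>A. a j \<bullet> a j) + 2 * x * y * (\<Sum>j\<in>A. a j \<bullet> b j) + y\<^sup>2 * (\<Sum>j\<in>A. b j \<bullet> b j)"
    for A and a b :: "nat \<Rightarrow> real ^ 'd"
    by (simp add: inner_add_left inner_add_right inner_commute power2_eq_square sum.distrib
        sum_distrib_left algebra_simps)
  have "centred_normal_moments
     (\<lambda>\<omega>. (\<Sum>j<K. (x *\<^sub>R P e k j + y *\<^sub>R P f l j) \<bullet> increment \<Delta> j \<omega>)
          + (\<Sum>j\<le>K. (x *\<^sub>R N e k j + y *\<^sub>R N f l j) \<bullet> \<epsilon> j \<omega>))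
     (\<Delta> * (\<Sum>j<K. (x *\<^sub>R P e k j + y *\<^sub>R P f l j) \<bullet> (x *\<^sub>R P e k j + y *\<^sub>R P f l j))
      + n * (\<Sum>j\<le>K. (x *\<^sub>R N e k j + y *\<^sub>R N f l j) \<bullet> (x *\<^sub>R N e k j + y *\<^sub>R N f l j)))"
    using assms by (intro linear_form_moments)
  moreover have "(\<Sum>j<K. (x *\<^sub>R P e k j + y *\<^sub>R P f l j) \<bullet> increment \<Delta> j \<omega>)
          + (\<Sum>j\<le>K. (x *\<^sub>R N e k j + y *\<^sub>R N f l j) \<bullet> \<epsilon> j \<omega>)
      = x * driven_increment \<Delta> e k \<omega> + y * driven_increment \<Delta> f l \<omega>" for \<omega>
    by (simp add: form k l inner_add_left sum.distrib sum_distrib_left algebra_simps)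
  moreover have "\<Delta> * (\<Sum>j<K. (x *\<^sub>R P e k j + y *\<^sub>R P f l j) \<bullet> (x *\<^sub>R P e k j + y *\<^sub>R P f l j))
      + n * (\<Sum>j\<le>K. (x *\<^sub>R N e k j + y *\<^sub>R N f l j) \<bullet> (x *\<^sub>R N e k j + y *\<^sub>R N f l j))
      = x\<^sup>2 * increment_covariance \<Delta> e k e k + 2 * x * y * increment_covariance \<Delta> e k f l
        + y\<^sup>2 * increment_covariance \<Delta> f l f l"
    unfolding bilin by (simp add: k l algebra_simps flip: cov)
  ultimately show ?thesis by simp
qed

lemma raw_gap_estimator_AE:
  assumes "0 < \<Delta>" and h: "h = real K * \<Delta>"
  shows "AE \<omega> in M. raw_gap_estimator e f \<Delta> K (observed t0 \<Delta> Y \<epsilon>) \<omega> =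
     1 / (real K * \<Delta>) * (\<Sum>k<K. (driven_increment \<Delta> e k \<omega>)\<^sup>2 - (driven_increment \<Delta> f k \<omega>)\<^sup>2)"
  using signal_sde
proof eventually_elim
  case (elim \<omega>)
  have grid: "t0 + real j * \<Delta> \<in> {t0..t0 + h}" if "j \<le> K" for j
    using that \<open>0 < \<Delta>\<close> by (simp add: h)
  have "observed t0 \<Delta> Y \<epsilon> (Suc k) \<omega> - observed t0 \<Delta> Y \<epsilon> k \<omega> = G *v increment \<Delta> k \<omega> + (\<epsilon> (Suc k) \<omega> - \<epsilon> k \<omega>)"
    if "k < K" for k
  proof -
    have "Y (t0 + real (Suc k) * \<Delta>) \<omega> - Y (t0 + real k * \<Delta>) \<omega> = G *v increment \<Delta> k \<omega>"
      using elim[THEN bspec, OF grid[of "Suc k"]] elim[THEN bspec, OF grid[of k]] that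
      by (simp add: increment_def matrix_vector_mult_diff_distrib del: of_nat_Suc)
    then show ?thesis
      unfolding observed_def by (metis add_diff_add)
  qed
  then show ?case
    by (simp add: raw_gap_estimator_def driven_increment_def)
qed

lemma raw_gap_estimator_measurable:
  assumes "0 < \<Delta>" and h: "h = real K * \<Delta>"
  shows "random_variable borel (raw_gap_estimator e f \<Delta> K (observed t0 \<Delta> Y \<epsilon>))"
proof -
  have [measurable]: "random_variable borel (observed t0 \<Delta> Y \<epsilon> k)" if "k \<le> K" for k
  proof -
    have "random_variable borel (Y (t0 + real k * \<Delta>))"
      using signal_measurable that \<open>0 < \<Delta>\<close> by (simp add: h)
    with noise_measurable[OF that] show ?thesis
      unfolding observed_def by measurable
  qed
  show ?thesis
    unfolding raw_gap_estimator_def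
    by (intro borel_measurable_times borel_measurable_const borel_measurable_sum
        borel_measurable_diff borel_measurable_power borel_measurable_inner) auto
qed

lemma driven_increment_measurable:
  assumes "0 < \<Delta>" and "k < K"
  shows "random_variable borel (driven_increment \<Delta> e k)"
proof -
  have [measurable]: "random_variable borel (W (t0 + real j * \<Delta>))" for j
    using start_nonneg \<open>0 < \<Delta>\<close> by (intro W_measurable) simp
  have [measurable]: "random_variable borel (\<epsilon> k)" "random_variable borel (\<epsilon> (Suc k))"
    using \<open>k < K\<close> by (auto intro: noise_measurable)
  have [measurable]: "(\<lambda>w. G *v w) \<in> borel_measurable borel"
    by (intro borel_measurable_continuous_onI) (rule matrix_vector_mult_linear_continuous_on)
  show ?thesis
    unfolding driven_increment_def increment_def by measurable
qed

text \<open>The squares are indexed by a direction and a time step, \<^const>\<open>True\<close> standing for the radial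
  direction.  Orthogonality of the frame of eigenvectors makes the covariance block diagonal, so the
  signs of the weights disappear on squaring and the two directions contribute independently.\<close>

lemma variance_raw_gap_estimator:
  assumes "0 < \<Delta>" and "0 \<le> n" and K: "1 \<le> K" and h: "h = real K * \<Delta>"
    and frame: "norm e\<^sub>\<rho> = 1" "norm e\<^sub>\<theta> = 1" "e\<^sub>\<rho> \<bullet> e\<^sub>\<theta> = 0"
    and eig: "G ** transpose G *v e\<^sub>\<rho> = lam\<^sub>\<rho> *\<^sub>R e\<^sub>\<rho>" "G ** transpose G *v e\<^sub>\<theta> = lam\<^sub>\<theta> *\<^sub>R e\<^sub>\<theta>"
  shows "variance (raw_gap_estimator e\<^sub>\<rho> e\<^sub>\<theta> \<Delta> K (observed t0 \<Delta> Y \<epsilon>)) =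
     2 / ((real K)\<^sup>2 * \<Delta>\<^sup>2) *
       (real K * ((lam\<^sub>\<rho> * \<Delta> + 2 * n)\<^sup>2 + (lam\<^sub>\<theta> * \<Delta> + 2 * n)\<^sup>2) + 4 * (real K - 1) * n\<^sup>2)"
proof -
  define d where "d s = (if s then e\<^sub>\<rho> else e\<^sub>\<theta>)" for s
  define c where "c s = (if s then lam\<^sub>\<rho> else lam\<^sub>\<theta>) * \<Delta> + 2 * n" for s
  define w where "w s = (if s then 1 else - 1) / (real K * \<Delta>)" for s
  define Z where "Z = (\<lambda>(s, k). driven_increment \<Delta> (d s) k)"
  define C where "C = (\<lambda>(s, k) (s', l). increment_covariance \<Delta> (d s) k (d s') l)"
  define I where "I = (UNIV :: bool set) \<times> {..<K}"
  let ?S = "\<lambda>\<omega>. \<Sum>i\<in>I. w (fst i) * (Z i \<omega>)\<^sup>2"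
  have inner: "e\<^sub>\<rho> \<bullet> e\<^sub>\<rho> = 1" "e\<^sub>\<theta> \<bullet> e\<^sub>\<theta> = 1" "e\<^sub>\<theta> \<bullet> e\<^sub>\<rho> = 0"
    using frame by (simp_all add: norm_eq_1 inner_commute)
  have C_eq: "C (s, k) (s', l) = of_bool (s = s') *
      (of_bool (k = l) * c s - (of_bool (k = Suc l) + of_bool (l = Suc k)) * n)" for s s' k l
    using frame inner eig by (simp add: C_def d_def c_def increment_covariance_def mult_ac)
  have S_eq: "?S \<omega> = 1 / (real K * \<Delta>) * (\<Sum>k<K. (driven_increment \<Delta> e\<^sub>\<rho> k \<omega>)\<^sup>2 - (driven_increment \<Delta> e\<^sub>\<theta> k \<omega>)\<^sup>2)"
    for \<omega>
    unfolding I_def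
    by (simp add: sum.cartesian_product' UNIV_bool Z_def w_def d_def sum_subtractf
        sum_distrib_left right_diff_distrib sum_negf)
  have S_meas: "random_variable borel ?S"
    unfolding S_eq using \<open>0 < \<Delta>\<close>
    by (intro borel_measurable_times borel_measurable_const borel_measurable_sum
        borel_measurable_diff borel_measurable_power driven_increment_measurable) auto
  have AE: "AE \<omega> in M. raw_gap_estimator e\<^sub>\<rho> e\<^sub>\<theta> \<Delta> K (observed t0 \<Delta> Y \<epsilon>) \<omega> = ?S \<omega>"
    using raw_gap_estimator_AE[OF \<open>0 < \<Delta>\<close> h] unfolding S_eq .
  note meas = raw_gap_estimator_measurable[OF \<open>0 < \<Delta>\<close> h, of e\<^sub>\<rho> e\<^sub>\<theta>]
  have mean: "expectation (raw_gap_estimator e\<^sub>\<rho> e\<^sub>\<theta> \<Delta> K (observed t0 \<Delta> Y \<epsilon>)) = expectation ?S"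
    using AE meas S_meas by (intro integral_cong_AE)
  have "variance (raw_gap_estimator e\<^sub>\<rho> e\<^sub>\<theta> \<Delta> K (observed t0 \<Delta> Y \<epsilon>)) = variance ?S"
    unfolding mean
  proof (rule integral_cong_AE)
    show "AE \<omega> in M. (raw_gap_estimator e\<^sub>\<rho> e\<^sub>\<theta> \<Delta> K (observed t0 \<Delta> Y \<epsilon>) \<omega> - expectation ?S)\<^sup>2
        = (?S \<omega> - expectation ?S)\<^sup>2"
      using AE by eventually_elim simp
  qed (intro borel_measurable_power borel_measurable_diff borel_measurable_const meas S_meas)+
  also have "\<dots> = 2 * (\<Sum>i\<in>I. \<Sum>j\<in>I. w (fst i) * w (fst j) * (C i j)\<^sup>2)"
  proof (rule variance_weighted_sum_squares)
    show "centred_normal_moments (\<lambda>\<omega>. x * Z i \<omega> + y * Z j \<omega>) (x\<^sup>2 * C i i + 2 * x * y * C i j + y\<^sup>2 * C j j)"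
      if "i \<in> I" "j \<in> I" for i j x y
      using that \<open>0 < \<Delta>\<close> \<open>0 \<le> n\<close>
      by (auto simp: I_def Z_def C_def intro!: driven_increment_pair_moments)
  qed
  also have "(\<Sum>i\<in>I. \<Sum>j\<in>I. w (fst i) * w (fst j) * (C i j)\<^sup>2) =
     (\<Sum>s\<in>UNIV. (w s)\<^sup>2 * (\<Sum>k<K. \<Sum>l<K. (of_bool (k = l) * c s - (of_bool (k = Suc l) + of_bool (l = Suc k)) * n)\<^sup>2))"
    unfolding I_def by (simp add: sum.cartesian_product' UNIV_bool C_eq sum_distrib_left
      power2_eq_square)
  also have "\<dots> = (\<Sum>s\<in>UNIV. (w s)\<^sup>2 * (real K * (c s)\<^sup>2 + 2 * (real K - 1) * n\<^sup>2))"
    by (simp only: sum_tridiagonal_squares[OF K])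
  also have "2 * \<dots> = 2 / ((real K)\<^sup>2 * \<Delta>\<^sup>2) *
       (real K * ((lam\<^sub>\<rho> * \<Delta> + 2 * n)\<^sup>2 + (lam\<^sub>\<theta> * \<Delta> + 2 * n)\<^sup>2) + 4 * (real K - 1) * n\<^sup>2)"
  proof -
    have "(w s)\<^sup>2 = 1 / ((real K)\<^sup>2 * \<Delta>\<^sup>2)" for s
      by (simp add: w_def power_divide power_mult_distrib)
    moreover have "2 * (1 / q * (r * x + 2 * t * z) + 1 / q * (r * y + 2 * t * z))
        = 2 / q * (r * (y + x) + 4 * t * z)" for q r t x y z :: real
      by (simp add: algebra_simps add_divide_distrib)
    ultimately show ?thesis
      by (simp only: UNIV_bool sum.insert finite_insert finite.emptyI sum.empty insert_iff empty_iff
          c_def if_True if_False add_0_right simp_thms)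
  qed
  finally show ?thesis .
qed

end

section \<open>Large samples and the optimal interval\<close>

text \<open>With \<open>D\<close> the bracket of \<open>V\<^sub>h(h / K)\<close> multiplied by \<open>h\<close>, the two variances are \<open>2 / h\<^sup>2\<close> times
  \<open>D - 4 n\<^sup>2\<close> and \<open>D\<close>.  As \<open>D \<ge> 12 n\<^sup>2 K\<close>, the ratio differs from 1 by at most \<open>1 / (3 K)\<close>.\<close>

lemma variance_ratio_tendsto_1:
  fixes n h lam\<^sub>\<rho> lam\<^sub>\<theta> :: real
  assumes "0 < n" and "0 < h" and "0 \<le> lam\<^sub>\<rho>" and "0 \<le> lam\<^sub>\<theta>"
  shows "(\<lambda>K. 2 / ((real K)\<^sup>2 * (h / real K)\<^sup>2) *
       (real K * ((lam\<^sub>\<rho> * (h / real K) + 2 * n)\<^sup>2 + (lam\<^sub>\<theta> * (h / real K) + 2 * n)\<^sup>2)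
         + 4 * (real K - 1) * n\<^sup>2) / V_approx n lam\<^sub>\<rho> lam\<^sub>\<theta> h (h / real K)) \<longlonglongrightarrow> 1"
    (is "?ratio \<longlonglongrightarrow> 1")
proof -
  define D where "D K = 12 * n\<^sup>2 * real K + 4 * n * h * (lam\<^sub>\<rho> + lam\<^sub>\<theta>)
      + (lam\<^sub>\<rho>\<^sup>2 + lam\<^sub>\<theta>\<^sup>2) * h\<^sup>2 / real K" for K
  have D_ge: "12 * n\<^sup>2 * real K \<le> D K" for K
    using assms by (simp add: D_def)
  have "?ratio K = 1 - 4 * n\<^sup>2 / D K" if "1 \<le> K" for K
  proof -
    have K: "0 < real K" using that by simp
    have "0 < 12 * n\<^sup>2 * real K" using K \<open>0 < n\<close> by simp
    with D_ge[of K] have D_pos: "0 < D K" by linarith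
    have V: "V_approx n lam\<^sub>\<rho> lam\<^sub>\<theta> h (h / real K) = 2 / h\<^sup>2 * D K"
      using K \<open>0 < h\<close> by (simp add: V_approx_def D_def field_simps power2_eq_square)
    have N: "real K * ((lam\<^sub>\<rho> * (h / real K) + 2 * n)\<^sup>2 + (lam\<^sub>\<theta> * (h / real K) + 2 * n)\<^sup>2)
         + 4 * (real K - 1) * n\<^sup>2 = D K - 4 * n\<^sup>2"
      using K by (simp add: D_def field_simps power2_eq_square)
    have S: "(real K)\<^sup>2 * (h / real K)\<^sup>2 = h\<^sup>2"
      using K by (simp add: power_divide)
    show ?thesis
      unfolding V N S using D_pos \<open>0 < h\<close> by (simp add: field_simps)
  qed
  then have eq: "eventually (\<lambda>K. 1 - 4 * n\<^sup>2 / D K = ?ratio K) sequentially"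
    unfolding eventually_sequentially by metis
  have "(\<lambda>K. 4 * n\<^sup>2 / D K) \<longlonglongrightarrow> 0"
  proof (rule tendsto_sandwich)
    show "eventually (\<lambda>K. 0 \<le> 4 * n\<^sup>2 / D K) sequentially"
      using D_ge by (intro always_eventually allI divide_nonneg_nonneg order_trans[OF _ D_ge]) auto
    have "4 * n\<^sup>2 / D K \<le> 1 / 3 * (1 / real K)" if "1 \<le> K" for K
    proof -
      have "4 * n\<^sup>2 / D K \<le> 4 * n\<^sup>2 / (12 * n\<^sup>2 * real K)"
        using that \<open>0 < n\<close> D_ge[of K] by (intro divide_left_mono mult_pos_pos) (auto intro: less_le_trans[OF _ D_ge])
      also have "\<dots> = 1 / 3 * (1 / real K)" using \<open>0 < n\<close> by simp
      finally show ?thesis .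
    qed
    then show "eventually (\<lambda>K. 4 * n\<^sup>2 / D K \<le> 1 / 3 * (1 / real K)) sequentially"
      unfolding eventually_sequentially by blast
    show "(\<lambda>K. 1 / 3 * (1 / real K)) \<longlonglongrightarrow> 0"
      using tendsto_mult_right_zero[OF lim_1_over_n] by blast
  qed simp
  then have "(\<lambda>K. 1 - 4 * n\<^sup>2 / D K) \<longlonglongrightarrow> 1"
    using tendsto_diff[OF tendsto_const[of 1]] by fastforce
  then show ?thesis
    using eq by (rule Lim_transform_eventually)
qed

text \<open>Up to the factor \<open>2 / h\<close> and a constant, the function is \<open>a / \<Delta> + b \<Delta>\<close> with \<open>a = 12 n\<^sup>2\<close> and
  \<open>b = \<lambda>\<^sub>\<rho>\<^sup>2 + \<lambda>\<^sub>\<theta>\<^sup>2\<close>.  Since \<open>a = b \<Delta>\<^sub>\<star>\<^sup>2\<close>, it exceeds its value at \<open>\<Delta>\<^sub>\<star>\<close> by \<open>b (\<Delta> - \<Delta>\<^sub>\<star>)\<^sup>2 / \<Delta>\<close>.\<close>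

lemma V_approx_arg_min:
  fixes n h lam\<^sub>\<rho> lam\<^sub>\<theta> :: real
  assumes "0 < n" and "0 < h" and "\<not> (lam\<^sub>\<rho> = 0 \<and> lam\<^sub>\<theta> = 0)"
  shows "is_arg_min (V_approx n lam\<^sub>\<rho> lam\<^sub>\<theta> h) (\<lambda>\<Delta>. 0 < \<Delta>) \<Delta> \<longleftrightarrow>
     \<Delta> = 2 * sqrt 3 * n / sqrt (lam\<^sub>\<rho>\<^sup>2 + lam\<^sub>\<theta>\<^sup>2)"
proof -
  define b where "b = lam\<^sub>\<rho>\<^sup>2 + lam\<^sub>\<theta>\<^sup>2"
  define \<Delta>' where "\<Delta>' = 2 * sqrt 3 * n / sqrt b"
  have "0 < b" using assms(3) by (simp add: b_def sum_power2_gt_zero_iff)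
  then have "0 < \<Delta>'" and "b * \<Delta>'\<^sup>2 = 12 * n\<^sup>2"
    using \<open>0 < n\<close> by (simp_all add: \<Delta>'_def power_divide power_mult_distrib)
  have excess: "V_approx n lam\<^sub>\<rho> lam\<^sub>\<theta> h D = V_approx n lam\<^sub>\<rho> lam\<^sub>\<theta> h \<Delta>' + 2 / h * (b * (D - \<Delta>')\<^sup>2 / D)"
    if "0 < D" for D
    using that \<open>0 < \<Delta>'\<close> \<open>0 < h\<close>
    unfolding V_approx_def \<open>b * \<Delta>'\<^sup>2 = 12 * n\<^sup>2\<close>[symmetric] b_def[symmetric]
    by (simp add: field_simps power2_eq_square)
  have "V_approx n lam\<^sub>\<rho> lam\<^sub>\<theta> h \<Delta>' < V_approx n lam\<^sub>\<rho> lam\<^sub>\<theta> h D" if "0 < D" "D \<noteq> \<Delta>'" for D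
    using excess[OF that(1)] that \<open>0 < b\<close> \<open>0 < h\<close> by simp
  then have "is_arg_min (V_approx n lam\<^sub>\<rho> lam\<^sub>\<theta> h) (\<lambda>\<Delta>. 0 < \<Delta>) \<Delta> \<longleftrightarrow> \<Delta> = \<Delta>'"
    using \<open>0 < \<Delta>'\<close> unfolding is_arg_min_def by (metis less_asym less_irrefl)
  then show ?thesis by (simp add: \<Delta>'_def b_def)
qed

theorem proposition9p1:
  fixes G :: "real ^ 'm ^ 2"
    and Q :: "real ^ 2 ^ 2"
    and e\<^sub>\<rho> e\<^sub>\<theta> :: "real ^ 2"
    and lam\<^sub>\<rho> lam\<^sub>\<theta> n :: real
  assumes "Q = G ** transpose G"
    and "norm e\<^sub>\<rho> = 1" and "norm e\<^sub>\<theta> = 1" and "e\<^sub>\<rho> \<bullet> e\<^sub>\<theta> = 0"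
    and "Q *v e\<^sub>\<rho> = lam\<^sub>\<rho> *\<^sub>R e\<^sub>\<rho>" and "Q *v e\<^sub>\<theta> = lam\<^sub>\<theta> *\<^sub>R e\<^sub>\<theta>"
    and "0 \<le> lam\<^sub>\<rho>" and "0 \<le> lam\<^sub>\<theta>" and "\<not> (lam\<^sub>\<rho> = 0 \<and> lam\<^sub>\<theta> = 0)"
    and "0 < n"
  shows
    "(\<forall>(M :: 'a measure) t0 h \<Delta> K W Y \<epsilon> c\<^sub>\<rho> c\<^sub>\<theta>.
        0 < \<Delta> \<and> 1 \<le> K \<and> h = real K * \<Delta> \<and>
        frozen_gaussian_model M t0 h G W Y n K \<epsilon> \<and>
        c\<^sub>\<rho> = lam\<^sub>\<rho> * \<Delta> + 2 * n \<and> c\<^sub>\<theta> = lam\<^sub>\<theta> * \<Delta> + 2 * n \<longrightarrow>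
        prob_space.variance M (raw_gap_estimator e\<^sub>\<rho> e\<^sub>\<theta> \<Delta> K (observed t0 \<Delta> Y \<epsilon>)) =
          2 / ((real K)\<^sup>2 * \<Delta>\<^sup>2) *
            (real K * (c\<^sub>\<rho>\<^sup>2 + c\<^sub>\<theta>\<^sup>2) + 4 * (real K - 1) * n\<^sup>2)) \<and>
     (\<forall>(M :: nat \<Rightarrow> 'a measure) t0 h W Y \<epsilon>.
        0 < h \<and>
        (\<forall>K\<ge>1. frozen_gaussian_model (M K) t0 h G (W K) (Y K) n K (\<epsilon> K)) \<longrightarrow>
        (\<lambda>K. prob_space.variance (M K)
               (raw_gap_estimator e\<^sub>\<rho> e\<^sub>\<theta> (h / real K) K
                 (observed t0 (h / real K) (Y K) (\<epsilon> K))) /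
             V_approx n lam\<^sub>\<rho> lam\<^sub>\<theta> h (h / real K)) \<longlonglongrightarrow> 1) \<and>
     (\<forall>h>0. \<forall>\<Delta>. is_arg_min (V_approx n lam\<^sub>\<rho> lam\<^sub>\<theta> h) (\<lambda>\<Delta>. 0 < \<Delta>) \<Delta> \<longleftrightarrow>
        \<Delta> = 2 * sqrt 3 * n / sqrt (lam\<^sub>\<rho>\<^sup>2 + lam\<^sub>\<theta>\<^sup>2))"
proof -
  have exact: "prob_space.variance M (raw_gap_estimator e\<^sub>\<rho> e\<^sub>\<theta> \<Delta> K (observed t0 \<Delta> Y \<epsilon>)) =
      2 / ((real K)\<^sup>2 * \<Delta>\<^sup>2) *
        (real K * ((lam\<^sub>\<rho> * \<Delta> + 2 * n)\<^sup>2 + (lam\<^sub>\<theta> * \<Delta> + 2 * n)\<^sup>2) + 4 * (real K - 1) * n\<^sup>2)"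
    if "0 < \<Delta>" "1 \<le> K" "h = real K * \<Delta>" "frozen_gaussian_model M t0 h G W Y n K \<epsilon>"
    for M :: "'a measure" and t0 h \<Delta> K W Y \<epsilon>
    using that assms by (intro frozen_gaussian_model.variance_raw_gap_estimator) auto
  have "(\<lambda>K. prob_space.variance (M K) (raw_gap_estimator e\<^sub>\<rho> e\<^sub>\<theta> (h / real K) K
               (observed t0 (h / real K) (Y K) (\<epsilon> K))) / V_approx n lam\<^sub>\<rho> lam\<^sub>\<theta> h (h / real K)) \<longlonglongrightarrow> 1"
    if h: "0 < h" and model: "\<And>K. 1 \<le> K \<Longrightarrow> frozen_gaussian_model (M K) t0 h G (W K) (Y K) n K (\<epsilon> K)"
    for M :: "nat \<Rightarrow> 'a measure" and t0 h W Y \<epsilon>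
  proof (rule Lim_transform_eventually[OF variance_ratio_tendsto_1[OF \<open>0 < n\<close> h \<open>0 \<le> lam\<^sub>\<rho>\<close> \<open>0 \<le> lam\<^sub>\<theta>\<close>]])
    show "eventually (\<lambda>K. 2 / ((real K)\<^sup>2 * (h / real K)\<^sup>2) *
       (real K * ((lam\<^sub>\<rho> * (h / real K) + 2 * n)\<^sup>2 + (lam\<^sub>\<theta> * (h / real K) + 2 * n)\<^sup>2)
         + 4 * (real K - 1) * n\<^sup>2) / V_approx n lam\<^sub>\<rho> lam\<^sub>\<theta> h (h / real K)
      = prob_space.variance (M K) (raw_gap_estimator e\<^sub>\<rho> e\<^sub>\<theta> (h / real K) K
          (observed t0 (h / real K) (Y K) (\<epsilon> K))) / V_approx n lam\<^sub>\<rho> lam\<^sub>\<theta> h (h / real K)) sequentially"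
      using eventually_ge_at_top[of 1]
    proof eventually_elim
      case (elim K)
      have "0 < h / real K" and "h = real K * (h / real K)"
        using elim h by simp_all
      from exact[OF this(1) elim this(2) model[OF elim]] show ?case by simp
    qed
  qed
  note ratio = this
  show ?thesis
  proof (intro conjI allI impI, goal_cases)
    case (1 M t0 h \<Delta> K W Y \<epsilon> c\<^sub>\<rho> c\<^sub>\<theta>)
    then show ?case using exact[of \<Delta> K h M t0 W Y \<epsilon>] by (elim conjE) simp
  next
    case (2 M t0 h W Y \<epsilon>)
    then show ?case using ratio[of h M t0 W Y \<epsilon>] by blast
  next
    case (3 h \<Delta>)
    then show ?case
      using V_approx_arg_min[OF \<open>0 < n\<close> _ \<open>\<not> (lam\<^sub>\<rho> = 0 \<and> lam\<^sub>\<theta> = 0)\<close>] by blast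
  qed
qed

end
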